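(* Let $D$ be a digraph on $n$ vertices, with Laplacian matrix $L(D)$ and Laplacian polytope $P_D$. The following are equivalent: 1. $D$ has positive complexity, i.e. $c(D)>0$; 2. $\operatorname{rank}(L(D)) = n-1$; 3. $P_D$ is an $(n-1)$-simplex (i.e. an $(n-1)$-dimensional simplex).
   Context: A digraph $D$ is a finite directed graph on the vertex set $[n]=\{1,\ldots,n\}$, without loops and without isolated vertices (vertices with indegree and outdegree both zero); multiple directed edges are allowed. A directed edge $(i,j)$ has tail $i$ and head $j$. Let $a_{i,j}$ be the number of edges with tail $i$ and head $j$ (so $a_{i,i}=0$), and let $\mathrm{outdeg}(i)=\sum_j a_{i,j}$. The Laplacian matrix of $D$ is $L(D)=O(D)-A(D)$, where $A(D)=(a_{i,j})$ and $O(D)$ is the diagonal matrix with entries $\mathrm{outdeg}(i)$. The Laplacian polytope of $D$ is $P_D=\operatorname{conv}\{\mathbf{v}_1,\ldots,\mathbf{v}_n\}\subset\mathbb{R}^n$, where $\mathbf{v}_i$ is the $i$-th row of $L(D)$. A converging tree is a digraph whose underlying undirected graph is connected and that has one vertex of outdegree zero (its root), all other vertices having outdegree one. A subgraph of $D$ is spanning if its vertex set is $[n]$. Let $c_i$ be the number of spanning converging trees of $D$ with root $i$ (parallel edges are regarded as distinct). The complexity of $D$ is $c(D)=\sum_{i=1}^n c_i$. *)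

theory Defs
  imports "HOL-Analysis.Analysis" "Graph_Theory.Digraph_Component"
begin

text \<open>
  Directed multigraphs are records of type \<^typ>\<open>('n, 'e) pre_digraph\<close>: an arc is an
  abstract element of \<^typ>\<open>'e\<close> with a tail and a head, so parallel arcs are distinct.
  The vertex set \<open>[n]\<close> is rendered as the universe of a finite type \<^typ>\<open>'n\<close>, so that
  \<open>n = CARD('n)\<close> and vectors indexed by vertices live in \<open>real ^ 'n\<close>.
\<close>

definition laplacian_digraph :: "('n::finite, 'e) pre_digraph \<Rightarrow> bool" where
  "laplacian_digraph D \<longleftrightarrow>
     fin_digraph D \<and> loopfree_digraph D \<and> verts D = UNIV \<and>
     (\<forall>v. \<not> (in_degree D v = 0 \<and> out_degree D v = 0))"

definition arc_mult :: "('n, 'e) pre_digraph \<Rightarrow> 'n \<Rightarrow> 'n \<Rightarrow> nat" where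
  "arc_mult D i j = card {e \<in> arcs D. tail D e = i \<and> head D e = j}"

definition adjacency_matrix :: "('n::finite, 'e) pre_digraph \<Rightarrow> real ^ 'n ^ 'n" where
  "adjacency_matrix D = (\<chi> i j. real (arc_mult D i j))"

definition outdegree_matrix :: "('n::finite, 'e) pre_digraph \<Rightarrow> real ^ 'n ^ 'n" where
  "outdegree_matrix D = (\<chi> i j. if i = j then real (out_degree D i) else 0)"

definition laplacian :: "('n::finite, 'e) pre_digraph \<Rightarrow> real ^ 'n ^ 'n" where
  "laplacian D = outdegree_matrix D - adjacency_matrix D"

definition laplacian_polytope :: "('n::finite, 'e) pre_digraph \<Rightarrow> (real ^ 'n) set" where
  "laplacian_polytope D = convex hull (range (\<lambda>i. row i (laplacian D)))"

text \<open>
  \<^const>\<open>Digraph_Component.connected\<close> is connectedness of the underlying undirected graph.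
  Finiteness is required because \<^const>\<open>out_degree\<close> is a cardinality, hence 0 for an infinite
  set of arcs.  A tree consisting of its root only is allowed here; it is never spanning in a
  digraph without isolated vertices.
\<close>

definition converging_tree :: "('n, 'e) pre_digraph \<Rightarrow> 'n \<Rightarrow> bool" where
  "converging_tree T r \<longleftrightarrow>
     fin_digraph T \<and> loopfree_digraph T \<and> Digraph_Component.connected T \<and>
     r \<in> verts T \<and> out_degree T r = 0 \<and> (\<forall>v \<in> verts T - {r}. out_degree T v = 1)"

text \<open>
  Subgraphs share the tail and head maps of the ambient digraph, so a spanning subgraph is
  determined by its set of arcs, and the set counted here is finite if \<open>D\<close> is.
\<close>

definition num_converging_trees :: "('n, 'e) pre_digraph \<Rightarrow> 'n \<Rightarrow> nat" where
  "num_converging_trees D r = card {T. spanning T D \<and> converging_tree T r}"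

definition complexity :: "('n, 'e) pre_digraph \<Rightarrow> nat" where
  "complexity D = (\<Sum>i\<in>verts D. num_converging_trees D i)"

end

theory Submission
  imports Defs
begin

text \<open>
  All three conditions say that some vertex \<open>r\<close> can be reached from every vertex.
  A spanning converging tree with root \<open>r\<close> is obtained by choosing at each other vertex an arc
  that decreases the distance to \<open>r\<close>.

  If \<open>r\<close> is reachable from everywhere, the maximum principle applied to \<open>L x = 0\<close> shows that the
  kernel of \<open>L\<close> consists of the constant vectors.  If no such \<open>r\<close> exists, there are two disjoint
  nonempty sets closed under outgoing arcs.  The rows indexed by a closed set \<open>A\<close> are supported
  on \<open>A\<close> and have coordinate sum 0, so they span a space of dimension at most \<open>|A| - 1\<close>; with
  two such sets the rank is at most \<open>n - 2\<close>.

  Finally \<open>c L = 0\<close> implies \<open>|c| L = 0\<close>, so 0 is a convex combination of the rows of \<open>L\<close>, and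
  hence the dimension of the polytope is the rank of \<open>L\<close>.
\<close>

section \<open>The Laplacian matrix\<close>

lemma laplacian_nth:
  "laplacian D $ i $ j = (if i = j then real (out_degree D i) else 0) - real (arc_mult D i j)"
  by (simp add: laplacian_def outdegree_matrix_def adjacency_matrix_def)

lemma out_degree_eq_sum_arc_mult:
  fixes D :: "('n::finite, 'e) pre_digraph"
  assumes "finite (arcs D)"
  shows "out_degree D i = (\<Sum>j\<in>UNIV. arc_mult D i j)"
proof -
  have "out_arcs D i = (\<Union>j\<in>UNIV. {e \<in> arcs D. tail D e = i \<and> head D e = j})"
    by auto
  then have "out_degree D i = card (\<Union>j\<in>UNIV. {e \<in> arcs D. tail D e = i \<and> head D e = j})"
    by (simp add: out_degree_def)
  also have "\<dots> = (\<Sum>j\<in>UNIV. card {e \<in> arcs D. tail D e = i \<and> head D e = j})"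
    using assms by (intro card_UN_disjoint) auto
  finally show ?thesis
    by (simp add: arc_mult_def)
qed

lemma arc_mult_pos_iff:
  assumes "finite (arcs D)"
  shows "arc_mult D i j > 0 \<longleftrightarrow> (i, j) \<in> arcs_ends D"
  using assms by (auto simp: arc_mult_def card_gt_0_iff arcs_ends_conv)

text \<open>The out-degree of \<open>i\<close> is the sum of the multiplicities
  \<open>arc_mult D i j\<close>, so the product collects differences of \<open>x\<close> along
  outgoing arcs. In this form constant vectors visibly lie in the kernel, and the maximum principle
  applies.\<close>

lemma laplacian_mult_vec:
  fixes D :: "('n::finite, 'e) pre_digraph"
  assumes "finite (arcs D)"
  shows "(laplacian D *v x) $ i = (\<Sum>j\<in>UNIV. real (arc_mult D i j) * (x $ i - x $ j))"
proof -
  have "(laplacian D *v x) $ i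
      = (\<Sum>j\<in>UNIV. (if i = j then real (out_degree D i) * x $ j else 0) - real (arc_mult D i j) * x $ j)"
    unfolding matrix_vector_mult_def vec_lambda_beta laplacian_nth
    by (intro sum.cong) (auto simp: algebra_simps)
  also have "\<dots> = real (out_degree D i) * x $ i - (\<Sum>j\<in>UNIV. real (arc_mult D i j) * x $ j)"
    by (simp add: sum_subtractf)
  finally show ?thesis
    by (simp add: out_degree_eq_sum_arc_mult[OF assms] sum_distrib_right sum_subtractf
        right_diff_distrib)
qed

lemma sum_row_laplacian:
  fixes D :: "('n::finite, 'e) pre_digraph"
  assumes "finite (arcs D)"
  shows "(\<Sum>j\<in>UNIV. laplacian D $ i $ j) = 0"
  using laplacian_mult_vec[OF assms, of 1 i] by (simp add: matrix_vector_mult_def)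

lemma rank_laplacian_less:
  fixes D :: "('n::finite, 'e) pre_digraph"
  assumes "finite (arcs D)"
  shows "rank (laplacian D) < CARD('n)"
proof -
  have "laplacian D *v 1 = 0"
    by (simp add: vec_eq_iff laplacian_mult_vec[OF assms])
  then have "rank (laplacian D) \<noteq> CARD('n)"
    using matrix_nonfull_linear_equations_eq[of "laplacian D"] by (metis zero_neq_one)
  with rank_bound[of "laplacian D"] show ?thesis
    by simp
qed

section \<open>Rank and reachability\<close>

text \<open>At a maximiser of \<open>x\<close> all terms of the weighted sum of differences are
  nonnegative. They add up to 0, so every out-neighbour is a maximiser too, and a directed walk
  carries the maximum to \<open>r\<close>.\<close>

lemma laplacian_kernel_max:
  fixes D :: "('n::finite, 'e) pre_digraph"
  assumes fin: "finite (arcs D)"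
    and root: "\<And>v. (v, r) \<in> (arcs_ends D)\<^sup>*"
    and ker: "laplacian D *v x = 0"
  shows "x $ i \<le> x $ r"
proof -
  obtain v where v: "\<And>j. x $ j \<le> x $ v"
    using Max_in[of "range (($) x)"] Max_ge[of "range (($) x)"] by fastforce
  have "x $ w = x $ v" if "(v, w) \<in> (arcs_ends D)\<^sup>*" for w
    using that
  proof (induction rule: rtrancl_induct)
    case (step y z)
    have "(\<Sum>j\<in>UNIV. real (arc_mult D y j) * (x $ y - x $ j)) = 0"
      using laplacian_mult_vec[OF fin, of x y] ker by simp
    then have "real (arc_mult D y z) * (x $ y - x $ z) = 0"
      using v step.IH by (subst (asm) sum_nonneg_eq_0_iff) auto
    with step show ?case
      using arc_mult_pos_iff[OF fin, of y z] by auto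
  qed simp
  from this[OF root] v[of i] show ?thesis
    by simp
qed

text \<open>One extra vector, \<open>axis r 1\<close>, completes the rows to a spanning set: a
  vector orthogonal to all of them lies in the kernel and vanishes at \<open>r\<close>, hence is 0.
  One vector raises the dimension by at most 1.\<close>

lemma rank_laplacian_eq_if_root:
  fixes D :: "('n::finite, 'e) pre_digraph"
  assumes fin: "finite (arcs D)"
    and root: "\<And>v. (v, r) \<in> (arcs_ends D)\<^sup>*"
  shows "rank (laplacian D) = CARD('n) - 1"
proof -
  let ?S = "insert (axis r 1) (rows (laplacian D))"
  have "\<not> dim ?S < DIM(real ^ 'n)"
  proof
    assume "dim ?S < DIM(real ^ 'n)"
    then obtain x where "x \<noteq> 0" and orth: "\<And>y. y \<in> span ?S \<Longrightarrow> orthogonal x y"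
      using orthogonal_to_subspace_exists by blast
    have "orthogonal x (axis r 1)"
      by (simp add: orth span_base)
    then have r: "x $ r = 0"
      by (simp add: orthogonal_def inner_axis)
    have ker: "laplacian D *v x = 0"
    proof -
      have "orthogonal x (row i (laplacian D))" for i
        by (rule orth) (auto intro!: span_base simp: rows_def)
      then show ?thesis
        by (simp add: vec_eq_iff matrix_vector_mul_component orthogonal_def inner_commute row_def)
    qed
    \<comment> \<open>The maximum principle for \<open>- x\<close> bounds \<open>x\<close> from
      below by \<open>x $ r\<close>.\<close>
    then have "laplacian D *v (- x) = 0"
      by (simp add: vec.neg)
    from laplacian_kernel_max[OF fin root ker] laplacian_kernel_max[OF fin root this] r
    have "x $ i = 0" for i
      by (metis minus_zero neg_le_iff_le order_antisym vector_uminus_component)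
    with \<open>x \<noteq> 0\<close> show False
      by (simp add: vec_eq_iff)
  qed
  moreover have "dim ?S \<le> rank (laplacian D) + 1"
    by (simp add: dim_insert row_rank_def)
  ultimately show ?thesis
    using rank_laplacian_less[OF fin] by simp
qed

text \<open>Closedness makes these rows vanish outside \<open>A\<close>. Since the row sums are 0,
  the coordinate at \<open>a\<close> is determined by the others, which then serve as the
  coefficients of the differences.\<close>

lemma rows_closed_set_in_span:
  fixes D :: "('n::finite, 'e) pre_digraph"
  assumes fin: "finite (arcs D)" and closed: "arcs_ends D `` A \<subseteq> A" and "a \<in> A"
  shows "(\<lambda>i. row i (laplacian D)) ` A
      \<subseteq> span ((\<lambda>j. axis j 1 - axis a 1) ` (A - {a}))"
proof (rule image_subsetI)
  fix i assume "i \<in> A"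
  let ?L = "\<lambda>j. laplacian D $ i $ j"
  have out: "?L j = 0" if "j \<notin> A" for j
    using closed \<open>i \<in> A\<close> that arc_mult_pos_iff[OF fin, of i j] by (auto simp: laplacian_nth)
  have "(\<Sum>j\<in>A. ?L j) = 0"
    using sum_row_laplacian[OF fin, of i] out sum.mono_neutral_left[of UNIV A ?L] by auto
  then have a: "?L a = - (\<Sum>j\<in>A - {a}. ?L j)"
    using \<open>a \<in> A\<close> by (simp add: sum.remove[of A a])
  have "row i (laplacian D) = (\<Sum>j\<in>A - {a}. ?L j *\<^sub>R (axis j 1 - axis a 1))"
  proof (rule vec_eq_iff[THEN iffD2], rule allI)
    fix k
    have "(\<Sum>j\<in>A - {a}. ?L j *\<^sub>R (axis j 1 - axis a 1)) $ k
        = (\<Sum>j\<in>A - {a}. (if j = k then ?L j else 0) - (if k = a then ?L j else 0))"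
      unfolding sum_component by (rule sum.cong) (auto simp: axis_def)
    also have "\<dots> = (if k \<in> A - {a} then ?L k else 0)
        - (if k = a then \<Sum>j\<in>A - {a}. ?L j else 0)"
      by (simp add: sum_subtractf)
    also have "\<dots> = ?L k"
      using a out by auto
    finally show "row i (laplacian D) $ k
        = (\<Sum>j\<in>A - {a}. ?L j *\<^sub>R (axis j 1 - axis a 1)) $ k"
      by (simp add: row_def)
  qed
  then show "row i (laplacian D) \<in> span ((\<lambda>j. axis j 1 - axis a 1) ` (A - {a}))"
    by (simp only:) (intro span_sum span_scale span_base imageI)
qed

text \<open>Each closed set saves one vector in a spanning set of the row space; the remaining rows
  are kept as they are. The additive form avoids truncated subtraction.\<close>

lemma rank_laplacian_disjoint_closed_sets:
  fixes D :: "('n::finite, 'e) pre_digraph"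
  assumes fin: "finite (arcs D)"
    and A: "arcs_ends D `` A \<subseteq> A" "A \<noteq> {}" and B: "arcs_ends D `` B \<subseteq> B" "B \<noteq> {}"
    and disj: "A \<inter> B = {}"
  shows "rank (laplacian D) + 2 \<le> CARD('n)"
proof -
  obtain a b where ab: "a \<in> A" "b \<in> B"
    using A B by blast
  let ?row = "\<lambda>i. row i (laplacian D)"
  let ?S = "(\<lambda>j. axis j 1 - axis a 1 :: real ^ 'n) ` (A - {a})"
  let ?T = "(\<lambda>j. axis j 1 - axis b 1 :: real ^ 'n) ` (B - {b})"
  let ?U = "?row ` (UNIV - (A \<union> B))"
  have "rows (laplacian D) = ?row ` A \<union> ?row ` B \<union> ?U"
    by (auto simp: rows_def)
  also have "\<dots> \<subseteq> span (?S \<union> ?T \<union> ?U)"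
  proof (intro Un_least)
    show "?row ` A \<subseteq> span (?S \<union> ?T \<union> ?U)"
      using rows_closed_set_in_span[OF fin A(1) ab(1)]
      by (rule order_trans) (auto intro!: span_mono)
    show "?row ` B \<subseteq> span (?S \<union> ?T \<union> ?U)"
      using rows_closed_set_in_span[OF fin B(1) ab(2)]
      by (rule order_trans) (auto intro!: span_mono)
    show "?U \<subseteq> span (?S \<union> ?T \<union> ?U)"
      by (auto intro: span_base)
  qed
  finally have "rank (laplacian D) \<le> card (?S \<union> ?T \<union> ?U)"
    unfolding row_rank_def by (intro dim_le_card) auto
  also have "\<dots> \<le> card ?S + card ?T + card ?U"
    by (meson add_le_mono card_Un_le order_refl order_trans)
  also have "\<dots> \<le> card (A - {a}) + card (B - {b}) + card (UNIV - (A \<union> B))"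
    by (intro add_mono card_image_le) auto
  finally have "rank (laplacian D) \<le> \<dots>" .
  moreover have "card (A - {a}) + 1 = card A" "card (B - {b}) + 1 = card B"
    using ab by (metis Suc_eq_plus1 card_Suc_Diff1 finite)+
  moreover have "card (UNIV - (A \<union> B)) + (card A + card B) = CARD('n)"
    using card_Un_disjoint[OF _ _ disj] card_Diff_subset[of "A \<union> B" UNIV]
      card_mono[of UNIV "A \<union> B"] by simp
  ultimately show ?thesis
    by linarith
qed

text \<open>Take \<open>r\<close> with the fewest reachable vertices. The sets reachable from
  \<open>v\<close> and from \<open>r\<close> are closed, so they share some \<open>u\<close>. By
  minimality \<open>u\<close> reaches as much as \<open>r\<close> does, in particular
  \<open>r\<close> itself, and so \<open>v\<close> reaches \<open>r\<close> through
  \<open>u\<close>.\<close>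

lemma root_if_closed_sets_meet:
  fixes R :: "('n::finite) rel"
  assumes meet: "\<And>A B. R `` A \<subseteq> A \<Longrightarrow> R `` B \<subseteq> B \<Longrightarrow> A \<noteq> {} \<Longrightarrow> B \<noteq> {} \<Longrightarrow> A \<inter> B \<noteq> {}"
  obtains r where "\<And>v. (v, r) \<in> R\<^sup>*"
proof -
  have closed: "R `` (R\<^sup>* `` {v}) \<subseteq> R\<^sup>* `` {v}" for v
    by auto
  obtain r where r: "\<And>v. card (R\<^sup>* `` {r}) \<le> card (R\<^sup>* `` {v})"
    using ex_has_least_nat[of "\<lambda>_. True" _ "\<lambda>v. card (R\<^sup>* `` {v})"] by blast
  have "(v, r) \<in> R\<^sup>*" for v
  proof -
    obtain u where u: "(v, u) \<in> R\<^sup>*" "(r, u) \<in> R\<^sup>*"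
      using meet[OF closed[of v] closed[of r]] by blast
    then have "R\<^sup>* `` {u} \<subseteq> R\<^sup>* `` {r}"
      by auto
    then have "R\<^sup>* `` {u} = R\<^sup>* `` {r}"
      using r[of u] by (simp add: card_seteq)
    with u show ?thesis
      by (metis Image_singleton_iff rtrancl.rtrancl_refl rtrancl_trans)
  qed
  then show thesis
    by (rule that)
qed

lemma rank_laplacian_eq_iff_root:
  fixes D :: "('n::finite, 'e) pre_digraph"
  assumes "finite (arcs D)"
  shows "rank (laplacian D) = CARD('n) - 1 \<longleftrightarrow> (\<exists>r. \<forall>v. (v, r) \<in> (arcs_ends D)\<^sup>*)"
proof
  assume rank: "rank (laplacian D) = CARD('n) - 1"
  show "\<exists>r. \<forall>v. (v, r) \<in> (arcs_ends D)\<^sup>*"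
  proof (rule root_if_closed_sets_meet[of "arcs_ends D"])
    fix A B assume "arcs_ends D `` A \<subseteq> A" "arcs_ends D `` B \<subseteq> B" "A \<noteq> {}" "B \<noteq> {}"
    then show "A \<inter> B \<noteq> {}"
      using rank_laplacian_disjoint_closed_sets[OF assms, of A B] rank by linarith
  qed blast
next
  assume "\<exists>r. \<forall>v. (v, r) \<in> (arcs_ends D)\<^sup>*"
  then show "rank (laplacian D) = CARD('n) - 1"
    using rank_laplacian_eq_if_root[OF assms] by blast
qed

section \<open>Spanning converging trees and reachability\<close>

text \<open>Induction along an undirected path that starts at \<open>r\<close>. An arc pointing back
  to the previous vertex extends the directed path at its front; an arc pointing forward must
  already be its first arc, because out-degrees are at most 1.\<close>

lemma converging_tree_reaches_root:
  assumes T: "converging_tree T r" and "v \<in> verts T"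
  shows "(v, r) \<in> (arcs_ends T)\<^sup>*"
proof -
  interpret fin_digraph T
    using T by (simp add: converging_tree_def)
  have "Digraph_Component.connected T" "r \<in> verts T"
    using T by (auto simp: converging_tree_def)
  then have "r \<rightarrow>\<^sup>*\<^bsub>mk_symmetric T\<^esub> v"
    using \<open>v \<in> verts T\<close> by (auto simp: connected_def strongly_connected_def)
  then have "(r, v) \<in> (parcs (mk_symmetric T))\<^sup>*"
    by (auto dest: reachable_rtranclI)
  then show ?thesis
  proof (induction rule: rtrancl_induct)
    case (step y z)
    then consider "(z, y) \<in> arcs_ends T" | e where "e \<in> arcs T" "tail T e = y" "head T e = z"
      by (auto simp: parcs_mk_symmetric arcs_ends_conv)
    then show ?case
    proof cases
      case 1
      with step.IH show ?thesis
        by (rule converse_rtrancl_into_rtrancl[rotated -1])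
    next
      case 2
      then have e: "e \<in> out_arcs T y"
        by simp
      have "y \<in> verts T"
        using 2 by auto
      have "y \<noteq> r"
        using T e by (auto simp: converging_tree_def out_degree_def finite_out_arcs)
      then have "out_degree T y = 1"
        using T \<open>y \<in> verts T\<close> by (simp add: converging_tree_def)
      then have only: "f = e" if "f \<in> out_arcs T y" for f
        using e that unfolding out_degree_def by (metis card_1_singletonE singletonD)
      \<comment> \<open>As \<open>y\<close> is not \<open>r\<close>, the directed path from
        \<open>y\<close> to \<open>r\<close> is nonempty. It has to leave \<open>y\<close> by the
        only outgoing arc \<open>e\<close>, so its remainder starts at \<open>z\<close>.\<close>
      from step.IH \<open>y \<noteq> r\<close> obtain w where w: "(y, w) \<in> arcs_ends T" "(w, r) \<in> (arcs_ends T)\<^sup>*"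
        by (meson converse_rtranclE)
      then obtain f where f: "f \<in> arcs T" "tail T f = y" "head T f = w"
        by (auto simp: arcs_ends_conv)
      then have "f = e"
        by (intro only) simp
      then have "w = z"
        using f(3) 2(3) by simp
      then show ?thesis
        using w(2) by simp
    qed
  qed simp
qed

text \<open>One arc is chosen at every vertex except \<open>r\<close>, which settles the
  out-degrees. Connectedness holds because the distance to \<open>r\<close> drops along every chosen
  arc, so following them ends at \<open>r\<close>.\<close>

lemma spanning_converging_tree_if_root:
  assumes "fin_digraph D" "loopfree_digraph D" and "r \<in> verts D"
    and root: "\<And>v. v \<in> verts D \<Longrightarrow> (v, r) \<in> (arcs_ends D)\<^sup>*"
  shows "\<exists>T. spanning T D \<and> converging_tree T r"
proof -
  interpret fin_digraph D by fact
  interpret loopfree_digraph D by fact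
  \<comment> \<open>The length of a shortest directed walk from \<open>v\<close> to
    \<open>r\<close>; by \<open>root\<close> such walks exist for all vertices of
    \<open>D\<close>.\<close>
  define d where "d v = (LEAST k. (v, r) \<in> (arcs_ends D) ^^ k)" for v
  have d: "(v, r) \<in> (arcs_ends D) ^^ d v" if "v \<in> verts D" for v
    using rtrancl_imp_relpow[OF root[OF that]] unfolding d_def by (metis LeastI)
  have "\<exists>e. e \<in> arcs D \<and> tail D e = v \<and> d (head D e) < d v" if v: "v \<in> verts D - {r}" for v
  proof -
    have "(v, r) \<in> (arcs_ends D) ^^ d v" "v \<noteq> r"
      using d v by auto
    \<comment> \<open>The zeroth power is the identity relation, so \<open>d v\<close> is positive.
      The first step of a shortest walk leads to a vertex at distance at most
      \<open>d v - 1\<close>.\<close>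
    then obtain k where k: "d v = Suc k" "(v, r) \<in> (arcs_ends D) ^^ Suc k"
      by (metis not0_implies_Suc relpow_0_E)
    obtain w where w: "(v, w) \<in> arcs_ends D" "(w, r) \<in> (arcs_ends D) ^^ k"
      using relpow_Suc_D2[OF k(2)] by blast
    have "d w \<le> k"
      unfolding d_def by (rule Least_le) (rule w(2))
    with w(1) k(1) show ?thesis
      by (auto simp: arcs_ends_conv)
  qed
  then have "\<exists>f. \<forall>v\<in>verts D - {r}. f v \<in> arcs D \<and> tail D (f v) = v \<and> d (head D (f v)) < d v"
    by (intro bchoice) blast
  then obtain f where f: "\<And>v. v \<in> verts D \<Longrightarrow> v \<noteq> r \<Longrightarrow> f v \<in> arcs D"
      "\<And>v. v \<in> verts D \<Longrightarrow> v \<noteq> r \<Longrightarrow> tail D (f v) = v"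
      "\<And>v. v \<in> verts D \<Longrightarrow> v \<noteq> r \<Longrightarrow> d (head D (f v)) < d v"
    by blast
  define T where "T = \<lparr>verts = verts D, arcs = f ` (verts D - {r}), tail = tail D, head = head D\<rparr>"
  have sel: "verts T = verts D" "arcs T = f ` (verts D - {r})" "tail T = tail D" "head T = head D"
    by (simp_all add: T_def)
  have arcs: "arcs T \<subseteq> arcs D"
    using f(1) by (auto simp: sel)
  interpret T: fin_digraph T
  proof unfold_locales
    fix e assume "e \<in> arcs T"
    with arcs have "e \<in> arcs D"
      by blast
    then show "tail T e \<in> verts T" "head T e \<in> verts T"
      by (simp_all add: sel)
  qed (simp_all add: sel)
  have "loopfree_digraph T"
  proof unfold_locales
    fix e assume "e \<in> arcs T"
    with arcs have "e \<in> arcs D"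
      by blast
    then show "tail T e \<noteq> head T e"
      by (simp add: sel no_loops)
  qed
  have span: "spanning T D"
    using arcs T.wf_digraph wf_digraph
    by (simp add: spanning_def subgraph_def compatible_def sel)
  \<comment> \<open>Since \<open>f u\<close> has tail \<open>u\<close>, the index set is empty for
    \<open>v = r\<close> and a singleton for any other vertex of \<open>D\<close>; one formula
    yields both degree computations.\<close>
  have out: "out_arcs T v = f ` {u. u \<in> verts D \<and> u \<noteq> r \<and> u = v}" for v
  proof -
    have "out_arcs T v = f ` {u. u \<in> verts D \<and> u \<noteq> r \<and> tail D (f u) = v}"
      by (auto simp: sel)
    also have "\<dots> = f ` {u. u \<in> verts D \<and> u \<noteq> r \<and> u = v}"
      by (simp add: f(2) cong: conj_cong)
    finally show ?thesis .
  qed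
  have deg_root: "out_degree T r = 0"
    by (simp add: out_degree_def out)
  have deg: "out_degree T v = 1" if "v \<in> verts D - {r}" for v
  proof -
    have "{u. u \<in> verts D \<and> u \<noteq> r \<and> u = v} = {v}"
      using that by blast
    then show ?thesis
      by (simp add: out_degree_def out)
  qed
  have reach: "v \<rightarrow>\<^sup>*\<^bsub>mk_symmetric T\<^esub> r" if "v \<in> verts D" for v
    using that
  proof (induction "d v" arbitrary: v rule: less_induct)
    case less
    show ?case
    proof (cases "v = r")
      case True
      with \<open>r \<in> verts D\<close> show ?thesis
        by (simp add: reachable_def sel)
    next
      case False
      then have v: "f v \<in> arcs D" "tail D (f v) = v" "d (head D (f v)) < d v"
        using f less.prems by auto
      then have "head D (f v) \<rightarrow>\<^sup>*\<^bsub>mk_symmetric T\<^esub> r"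
        using less.hyps by simp
      moreover have "(v, head D (f v)) \<in> arcs_ends (mk_symmetric T)"
        using v less.prems False by (auto simp: parcs_mk_symmetric sel intro!: bexI[of _ v])
      ultimately show ?thesis
        using less.prems unfolding reachable_def
        by (auto intro: converse_rtrancl_on_into_rtrancl_on simp: sel)
    qed
  qed
  \<comment> \<open>So far every vertex is joined to \<open>r\<close>; symmetry reverses such a
    path, and any two vertices are then joined via \<open>r\<close>.\<close>
  have "sym (rtrancl_on (verts (mk_symmetric T)) (arcs_ends (mk_symmetric T)))"
    using symmetric_mk_symmetric[of T] by (intro rtrancl_on_sym) (simp add: symmetric_def)
  then have "u \<rightarrow>\<^sup>*\<^bsub>mk_symmetric T\<^esub> v" if "u \<in> verts D" "v \<in> verts D" for u v
    using reach[OF that(1)] reach[OF that(2)] unfolding reachable_def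
    by (meson rtrancl_on_trans symD)
  then have "Digraph_Component.connected T"
    using \<open>r \<in> verts D\<close> by (auto simp: connected_def strongly_connected_def sel)
  then have "converging_tree T r"
    using \<open>loopfree_digraph T\<close> T.fin_digraph deg_root deg \<open>r \<in> verts D\<close>
    by (simp add: converging_tree_def sel)
  with span show ?thesis
    by blast
qed

text \<open>As \<open>card\<close> is 0 on infinite sets, the existence of a tree makes the count
  positive only once finiteness is known.\<close>

lemma finite_spanning_subgraphs:
  assumes "finite (arcs D)"
  shows "finite {T. spanning T D}"
proof (rule finite_subset)
  show "{T. spanning T D}
      \<subseteq> (\<lambda>E. \<lparr>verts = verts D, arcs = E, tail = tail D, head = head D\<rparr>) ` Pow (arcs D)"
    by (auto simp: spanning_def subgraph_def compatible_def intro!: image_eqI pre_digraph.equality)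
  show "finite \<dots>"
    using assms by simp
qed

lemma complexity_pos_iff_root:
  assumes "fin_digraph D" "loopfree_digraph D"
  shows "complexity D > 0 \<longleftrightarrow> (\<exists>r\<in>verts D. \<forall>v\<in>verts D. (v, r) \<in> (arcs_ends D)\<^sup>*)"
proof -
  interpret fin_digraph D by fact
  have "finite {T. spanning T D \<and> converging_tree T r}" for r
    by (rule finite_subset[OF _ finite_spanning_subgraphs[OF finite_arcs]]) auto
  then have "complexity D > 0 \<longleftrightarrow> (\<exists>r\<in>verts D. \<exists>T. spanning T D \<and> converging_tree T r)"
    by (auto simp: complexity_def num_converging_trees_def zero_less_iff_neq_zero card_gt_0_iff)
  also have "\<dots> \<longleftrightarrow> (\<exists>r\<in>verts D. \<forall>v\<in>verts D. (v, r) \<in> (arcs_ends D)\<^sup>*)"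
  proof (intro bex_cong refl iffI ballI)
    fix r v assume "\<exists>T. spanning T D \<and> converging_tree T r" "v \<in> verts D"
    then obtain T where T: "spanning T D" "converging_tree T r" "v \<in> verts T"
      by (auto simp: spanning_def)
    have "arcs_ends T \<subseteq> arcs_ends D"
      using T(1) by (auto simp: spanning_def intro: arcs_ends_mono[THEN subsetD])
    then show "(v, r) \<in> (arcs_ends D)\<^sup>*"
      using converging_tree_reaches_root[OF T(2,3)] rtrancl_mono by blast
  next
    fix r assume "r \<in> verts D" "\<forall>v\<in>verts D. (v, r) \<in> (arcs_ends D)\<^sup>*"
    then show "\<exists>T. spanning T D \<and> converging_tree T r"
      using spanning_converging_tree_if_root[OF assms] by blast
  qed
  finally show ?thesis .
qed

section \<open>The Laplacian polytope\<close>

text \<open>Column \<open>j\<close> of the hypothesis equates \<open>c j\<close> times the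
  out-degree of \<open>j\<close> with the weighted inflow into \<open>j\<close>. The triangle
  inequality turns this into an inequality for absolute values at each \<open>j\<close>. Summed over
  all \<open>j\<close>, both sides agree, so no inequality is strict.\<close>

lemma laplacian_left_kernel_abs:
  fixes D :: "('n::finite, 'e) pre_digraph"
  assumes fin: "finite (arcs D)"
    and c: "\<And>j. (\<Sum>i\<in>UNIV. c i * laplacian D $ i $ j) = 0"
  shows "(\<Sum>i\<in>UNIV. \<bar>c i\<bar> * laplacian D $ i $ j) = 0"
proof -
  have col: "(\<Sum>i\<in>UNIV. b i * laplacian D $ i $ j)
      = b j * real (out_degree D j) - (\<Sum>i\<in>UNIV. b i * real (arc_mult D i j))" for b j
  proof -
    have "(\<Sum>i\<in>UNIV. b i * laplacian D $ i $ j) = (\<Sum>i\<in>UNIV.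
        (if i = j then b i * real (out_degree D i) else 0) - b i * real (arc_mult D i j))"
      by (intro sum.cong) (auto simp: laplacian_nth algebra_simps)
    then show ?thesis
      by (simp add: sum_subtractf)
  qed
  have le: "\<bar>c j\<bar> * real (out_degree D j) \<le> (\<Sum>i\<in>UNIV. \<bar>c i\<bar> * real (arc_mult D i j))" for j
  proof -
    have "c j * real (out_degree D j) = (\<Sum>i\<in>UNIV. c i * real (arc_mult D i j))"
      using c[of j] col[of c j] by simp
    then have "\<bar>c j\<bar> * real (out_degree D j) = \<bar>\<Sum>i\<in>UNIV. c i * real (arc_mult D i j)\<bar>"
      by (metis abs_mult abs_of_nat)
    also have "\<dots> \<le> (\<Sum>i\<in>UNIV. \<bar>c i * real (arc_mult D i j)\<bar>)"
      by (rule sum_abs)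
    finally show ?thesis
      by (simp add: abs_mult)
  qed
  \<comment> \<open>After the swap, the inner sum over the heads \<open>j\<close> gives the
    out-degree of \<open>i\<close>.\<close>
  have "(\<Sum>j\<in>UNIV. \<Sum>i\<in>UNIV. \<bar>c i\<bar> * real (arc_mult D i j))
      = (\<Sum>i\<in>UNIV. \<Sum>j\<in>UNIV. \<bar>c i\<bar> * real (arc_mult D i j))"
    by (rule sum.swap)
  then have "(\<Sum>j\<in>UNIV. \<bar>c j\<bar> * real (out_degree D j))
      = (\<Sum>j\<in>UNIV. \<Sum>i\<in>UNIV. \<bar>c i\<bar> * real (arc_mult D i j))"
    by (simp add: out_degree_eq_sum_arc_mult[OF fin] sum_distrib_left)
  from sum_mono_inv[OF this le, of j] show ?thesis
    by (simp add: col)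
qed

text \<open>The matrix is singular, so its left kernel contains a nonzero \<open>c\<close>. The
  absolute values of its entries, divided by their sum, are the coefficients of a convex combination
  of the rows that equals 0.\<close>

lemma zero_in_laplacian_polytope:
  fixes D :: "('n::finite, 'e) pre_digraph"
  assumes fin: "finite (arcs D)"
  shows "0 \<in> laplacian_polytope D"
proof -
  have "rank (transpose (laplacian D)) \<noteq> CARD('n)"
    using rank_laplacian_less[OF fin] by (simp add: rank_transpose)
  then obtain c where "c \<noteq> 0" and c: "transpose (laplacian D) *v c = 0"
    using matrix_nonfull_linear_equations_eq by blast
  have "(\<Sum>i\<in>UNIV. c $ i * laplacian D $ i $ j) = 0" for j
    using c by (simp add: vec_eq_iff matrix_vector_mult_def transpose_def mult.commute)
  then have abs_ker: "(\<Sum>i\<in>UNIV. \<bar>c $ i\<bar> * laplacian D $ i $ j) = 0" for j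
    by (rule laplacian_left_kernel_abs[OF fin])
  define s where "s = (\<Sum>i\<in>UNIV. \<bar>c $ i\<bar>)"
  obtain k where "c $ k \<noteq> 0"
    using \<open>c \<noteq> 0\<close> by (auto simp: vec_eq_iff)
  then have "s > 0"
    unfolding s_def by (intro sum_pos2[where i = k]) auto
  have "(\<Sum>i\<in>UNIV. (\<bar>c $ i\<bar> / s) *\<^sub>R row i (laplacian D)) \<in> laplacian_polytope D"
    unfolding laplacian_polytope_def
  proof (rule convex_sum)
    show "(\<Sum>i\<in>UNIV. \<bar>c $ i\<bar> / s) = 1"
      using \<open>s > 0\<close> by (simp add: s_def flip: sum_divide_distrib)
  qed (use \<open>s > 0\<close> in \<open>auto intro: hull_inc\<close>)
  moreover have "(\<Sum>i\<in>UNIV. (\<bar>c $ i\<bar> / s) *\<^sub>R row i (laplacian D)) = 0"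
    using abs_ker by (simp add: vec_eq_iff row_def flip: sum_divide_distrib)
  ultimately show ?thesis
    by simp
qed

text \<open>Once 0 lies in the affine hull of the rows, that hull is their linear span.\<close>

lemma aff_dim_laplacian_polytope:
  fixes D :: "('n::finite, 'e) pre_digraph"
  assumes "finite (arcs D)"
  shows "aff_dim (laplacian_polytope D) = int (rank (laplacian D))"
proof -
  have rows: "range (\<lambda>i. row i (laplacian D)) = rows (laplacian D)"
    by (auto simp: rows_def)
  have "0 \<in> affine hull (rows (laplacian D))"
    using zero_in_laplacian_polytope[OF assms] convex_hull_subset_affine_hull
    unfolding laplacian_polytope_def rows by blast
  then show ?thesis
    by (simp add: laplacian_polytope_def rows aff_dim_convex_hull aff_dim_zero row_rank_def)
qed

text \<open>The family may have repetitions, but affine dimension n - 1 forces n distinct points,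
  and n points of that affine dimension are affinely independent.\<close>

lemma simplex_convex_hull_range_iff:
  fixes f :: "'n::finite \<Rightarrow> 'a::euclidean_space"
  shows "(int CARD('n) - 1) simplex (convex hull (range f))
    \<longleftrightarrow> aff_dim (convex hull (range f)) = int CARD('n) - 1"
proof
  assume dim: "aff_dim (convex hull (range f)) = int CARD('n) - 1"
  have "card (range f) \<le> CARD('n)"
    by (simp add: card_image_le)
  moreover have "aff_dim (range f) \<le> int (card (range f)) - 1"
    by (rule aff_dim_le_card) simp
  ultimately have "card (range f) = CARD('n)"
    using dim by (simp add: aff_dim_convex_hull)
  then have "\<not> affine_dependent (range f)"
    using dim by (simp add: aff_dim_convex_hull affine_independent_iff_card)
  then show "(int CARD('n) - 1) simplex (convex hull (range f))"
    using \<open>card (range f) = CARD('n)\<close> by (auto simp: simplex_def)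
qed (rule aff_dim_simplex)

theorem proposition4:
  fixes D :: "('n::finite, 'e) pre_digraph"
  assumes "laplacian_digraph D"
  shows "(complexity D > 0 \<longleftrightarrow> rank (laplacian D) = CARD('n) - 1) \<and>
         (rank (laplacian D) = CARD('n) - 1 \<longleftrightarrow>
            (int CARD('n) - 1) simplex laplacian_polytope D)"
proof
  have D: "fin_digraph D" "loopfree_digraph D" and verts: "verts D = UNIV"
    using assms by (auto simp: laplacian_digraph_def)
  have fin: "finite (arcs D)"
    by (rule fin_digraph.finite_arcs[OF D(1)])
  show "complexity D > 0 \<longleftrightarrow> rank (laplacian D) = CARD('n) - 1"
    using complexity_pos_iff_root[OF D] rank_laplacian_eq_iff_root[OF fin] verts by simp
  have "(int CARD('n) - 1) simplex laplacian_polytope D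
      \<longleftrightarrow> aff_dim (laplacian_polytope D) = int CARD('n) - 1"
    unfolding laplacian_polytope_def by (rule simplex_convex_hull_range_iff)
  \<comment> \<open>The strict rank bound shows \<open>CARD('n)\<close> to be positive, so
    subtracting 1 gives the same in \<open>nat\<close> and in \<open>int\<close>.\<close>
  also have "\<dots> \<longleftrightarrow> rank (laplacian D) = CARD('n) - 1"
    using rank_laplacian_less[OF fin] by (auto simp: aff_dim_laplacian_polytope[OF fin])
  finally show "rank (laplacian D) = CARD('n) - 1 \<longleftrightarrow>
      (int CARD('n) - 1) simplex laplacian_polytope D"
    by simp
qed

end
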